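(* Let $x^1,\ldots,x^N\in\mathbb{S}^{n-1}$. For nonempty $I\subseteq\{1,\ldots,N\}$ let $X_I$ be the matrix with columns $x^i$ ($i\in I$), $\tilde X_I:=\begin{pmatrix}X_I\\-\mathbf{1}^T\end{pmatrix}$, $\tilde X:=\tilde X_{\{1,\ldots,N\}}$, and $\gamma_I:=\mathbf{1}^T(\tilde X_I^T\tilde X_I)^{-1}\mathbf{1}$ (defined when $\tilde X_I$ has full column rank). Define the finite families \[ \Phi_1:=\{I\subseteq\{1,\ldots,N\}\mid 1\le\mathrm{rank}\,\tilde X_I=\#I\le\min\{n,\mathrm{rank}\,\tilde X\},\ \gamma_I<1\}, \] \[ \Phi_0:=\{I\subseteq\{1,\ldots,N\}\mid 1\le\mathrm{rank}\,\tilde X_I=\#I=\min\{n,\mathrm{rank}\,\tilde X\},\ \gamma_I=1\}. \] For $I\in\Phi_1$ put $t_I:=((1-\gamma_I)/\gamma_I)^{1/2}$ and $w_I:=\frac{1+t_I^2}{t_I}X_I(\tilde X_I^T\tilde X_I)^{-1}\mathbf{1}$; for $I\in\Phi_0$ put $t_I:=0$ and let $w_I\in\mathrm{Ker}\,X_I^T\cap\mathbb{S}^{n-1}$ be arbitrary. Let $\Delta_1:=\max_{I\in\Phi_1}\max\{\Delta(w_I,t_I),\Delta(-w_I,-t_I)\}$ if $\Phi_1\ne\emptyset$ and $\Delta_1:=0$ otherwise, and $\Delta_0:=\max_{I\in\Phi_0}\max\{\Delta(w_I,0),\Delta(-w_I,0)\}$ if $\Phi_0\ne\emptyset$ and $\Delta_0:=0$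 otherwise. Then the spherical cap discrepancy satisfies $\Delta=\max\{\Delta_1,\Delta_0\}$ (for any choice of the $w_I$, $I\in\Phi_0$).
   Context: $\mathbf{1}$ denotes the all-ones vector of appropriate length; $\mathrm{Ker}\,X_I^T=\{w\in\mathbb{R}^n\mid\langle w,x^i\rangle=0\ \forall i\in I\}$. For $w\in\mathbb{S}^{n-1}$, $t\in[-1,1]$ let $H(w,t):=\{x\in\mathbb{R}^n\mid\langle w,x\rangle\ge t\}$, $\mu^{emp}(w,t):=N^{-1}\#\{i\mid x^i\in H(w,t)\}$, $\mu^{cap}(w,t):=\mu(\mathbb{S}^{n-1}\cap H(w,t))$ where $\mu$ is the uniform probability measure on $\mathbb{S}^{n-1}$, $\Delta(w,t):=|\mu^{emp}(w,t)-\mu^{cap}(w,t)|$, and the spherical cap discrepancy is $\Delta:=\sup_{w\in\mathbb{S}^{n-1},\,t\in[-1,1]}\Delta(w,t)$. *)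

theory Defs
  imports "HOL-Probability.Probability"
begin

section \<open>The uniform probability measure on the unit sphere\<close>

text \<open>
  The uniform distribution on the unit ball, projected radially to the sphere. This is the
  normalised surface measure, i.e. the rotation-invariant Borel probability measure carried by
  the sphere (see \<open>prob_space_sphere_unif\<close>, \<open>AE_sphere_unif\<close> and
  \<open>sphere_unif_invariant\<close>). It is a measure on the Borel sets of the whole space.
  In dimension one it gives mass one half to each of the two points of the sphere.
\<close>

definition sphere_unif :: "(real^'n) measure" where
  "sphere_unif = distr (uniform_measure lborel (ball 0 1)) borel sgn"

lemma sets_sphere_unif [simp, measurable_cong]: "sets sphere_unif = sets borel"
  and space_sphere_unif [simp]: "space sphere_unif = UNIV"
  by (simp_all add: sphere_unif_def)

lemma emeasure_unit_ball:
  "emeasure lborel (ball (0::real^'n) 1) \<noteq> 0" "emeasure lborel (ball (0::real^'n) 1) \<noteq> \<infinity>"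
proof -
  have "emeasure lborel (ball (0::real^'n) 1) = ennreal (measure lborel (ball (0::real^'n) 1))"
    by (rule emeasure_eq_ennreal_measure) (use emeasure_lborel_ball_finite[of "0::real^'n" 1] in auto)
  moreover have "measure lborel (ball (0::real^'n) 1) > 0"
    using content_ball_pos[of 1 "0::real^'n"] by simp
  ultimately show "emeasure lborel (ball (0::real^'n) 1) \<noteq> 0"
    "emeasure lborel (ball (0::real^'n) 1) \<noteq> \<infinity>"
    by auto
qed

lemma prob_space_sphere_unif: "prob_space (sphere_unif :: (real^'n) measure)"
  unfolding sphere_unif_def
  by (intro prob_space.prob_space_distr prob_space_uniform_measure emeasure_unit_ball) auto

lemma AE_sphere_unif: "AE x in (sphere_unif :: (real^'n) measure). x \<in> sphere 0 1"
proof -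
  have "AE x in lborel. x \<noteq> (0::real^'n)"
    by (rule AE_lborel_singleton)
  then have "AE x in uniform_measure lborel (ball (0::real^'n) 1). sgn x \<in> sphere 0 1"
    by (intro AE_uniform_measureI) (auto simp: norm_sgn)
  then show ?thesis
    unfolding sphere_unif_def by (subst AE_distr_iff) auto
qed

lemma nn_integral_lborel_shift:
  fixes f :: "'a::euclidean_space \<Rightarrow> ennreal"
  assumes [measurable]: "f \<in> borel_measurable borel"
  shows "(\<integral>\<^sup>+y. f (y - a) \<partial>lborel) = (\<integral>\<^sup>+y. f y \<partial>lborel)"
    and "(\<integral>\<^sup>+y. f (a - y) \<partial>lborel) = (\<integral>\<^sup>+y. f y \<partial>lborel)"
proof -
  have *: "(\<integral>\<^sup>+y. g y \<partial>lborel) = (\<integral>\<^sup>+y. g (b + y) \<partial>lborel)"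
    if [measurable]: "g \<in> borel_measurable borel" for g :: "'a \<Rightarrow> ennreal" and b
    by (subst lborel_distr_plus[of b, symmetric], subst nn_integral_distr) auto
  show "(\<integral>\<^sup>+y. f (y - a) \<partial>lborel) = (\<integral>\<^sup>+y. f y \<partial>lborel)"
    by (subst *[of f "- a"]) simp_all
  have "(\<integral>\<^sup>+y. f y \<partial>lborel) = (\<integral>\<^sup>+y. f (a - y) \<partial>lborel)"
    by (subst lborel_affine[of "-1" a]) (simp_all add: density_1 nn_integral_distr)
  then show "(\<integral>\<^sup>+y. f (a - y) \<partial>lborel) = (\<integral>\<^sup>+y. f y \<partial>lborel)" by simp
qed

lemma emeasure_lborel_orthogonal_vimage:
  fixes T :: "real^'n \<Rightarrow> real^'n"
  assumes T: "orthogonal_transformation T" and A [measurable]: "A \<in> sets borel"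
  shows "emeasure lborel (T -` A) = emeasure lborel A"
proof -
  let ?B = "ball (0::real^'n) 1"
  have lin: "linear T" using T by (rule orthogonal_transformation_linear)
  have bT [measurable]: "T \<in> borel_measurable borel"
    using lin by (intro borel_measurable_continuous_onI linear_continuous_on)
      (simp add: linear_conv_bounded_linear[symmetric])
  have TA [measurable]: "T -` A \<in> sets borel"
    using measurable_sets[OF bT A] by simp
  let ?m = "emeasure lborel :: (real^'n) set \<Rightarrow> ennreal"
  define a where "a = (indicator A :: real^'n \<Rightarrow> ennreal)"
  define b where "b = (indicator ?B :: real^'n \<Rightarrow> ennreal)"
  have am [measurable]: "a \<in> borel_measurable borel"
    unfolding a_def by (rule borel_measurable_indicator[OF A])
  have bm [measurable]: "b \<in> borel_measurable borel"
    unfolding b_def by (rule borel_measurable_indicator) simp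
  have bT_inv: "b (T x) = b x" for x
    using T by (simp add: b_def indicator_def orthogonal_transformation_norm)
  have int_a: "(\<integral>\<^sup>+y. a (y - c) \<partial>lborel) = ?m A" for c
    by (subst nn_integral_lborel_shift(1)[OF am]) (simp_all add: a_def)
  have int_b: "(\<integral>\<^sup>+y. b (y - c) \<partial>lborel) = ?m ?B" for c
    by (subst nn_integral_lborel_shift(1)[OF bm]) (simp_all add: b_def)
  have Tinv: "\<exists>z. T z = y" for y
    using orthogonal_transformation_surj[OF T] by (metis surjD)
  have "?m (T -` A) * ?m ?B = (\<integral>\<^sup>+x. a (T x) * ?m ?B \<partial>lborel)"
  proof -
    have "(\<integral>\<^sup>+x. a (T x) \<partial>lborel) = (\<integral>\<^sup>+x. indicator (T -` A) x \<partial>lborel)"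
      by (intro nn_integral_cong) (simp add: a_def indicator_def)
    then show ?thesis by (subst nn_integral_multc) auto
  qed
  also have "\<dots> = (\<integral>\<^sup>+x. (\<integral>\<^sup>+y. a (T x) * b (y - T x) \<partial>lborel) \<partial>lborel)"
    by (intro nn_integral_cong, subst nn_integral_cmult) (simp_all add: int_b)
  also have "\<dots> = (\<integral>\<^sup>+y. (\<integral>\<^sup>+x. a (T x) * b (y - T x) \<partial>lborel) \<partial>lborel)"
    by (rule lborel_pair.Fubini') measurable
  also have "\<dots> = (\<integral>\<^sup>+y. (\<integral>\<^sup>+x. a (y - T x) * b x \<partial>lborel) \<partial>lborel)"
  proof (rule nn_integral_cong)
    fix y :: "real^'n"
    obtain z where z: "T z = y" using Tinv by blast
    have "(\<integral>\<^sup>+x. a (T x) * b (y - T x) \<partial>lborel)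
        = (\<integral>\<^sup>+x. a (T (z - x)) * b (y - T (z - x)) \<partial>lborel)"
      by (rule nn_integral_lborel_shift(2)[symmetric]) measurable
    also have "\<dots> = (\<integral>\<^sup>+x. a (y - T x) * b x \<partial>lborel)"
      by (simp add: linear_diff[OF lin] z bT_inv)
    finally show "(\<integral>\<^sup>+x. a (T x) * b (y - T x) \<partial>lborel)
        = (\<integral>\<^sup>+x. a (y - T x) * b x \<partial>lborel)" .
  qed
  also have "\<dots> = (\<integral>\<^sup>+x. (\<integral>\<^sup>+y. a (y - T x) * b x \<partial>lborel) \<partial>lborel)"
    by (rule lborel_pair.Fubini'[symmetric]) measurable
  also have "\<dots> = (\<integral>\<^sup>+x. ?m A * b x \<partial>lborel)"
    by (intro nn_integral_cong, subst nn_integral_multc) (simp_all add: int_a)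
  also have "\<dots> = ?m A * ?m ?B"
    using bm by (subst nn_integral_cmult) (simp_all add: b_def)
  finally show ?thesis
    using emeasure_unit_ball[where 'n='n]
    by (simp add: mult.commute[of _ "?m ?B"] ennreal_mult_cancel_left)
qed

lemma sphere_unif_invariant:
  fixes T :: "real^'n \<Rightarrow> real^'n"
  assumes T: "orthogonal_transformation T"
  shows "distr sphere_unif borel T = sphere_unif"
proof (rule measure_eqI)
  have lin: "linear T" using T by (rule orthogonal_transformation_linear)
  have bT [measurable]: "T \<in> borel_measurable borel"
    using lin by (intro borel_measurable_continuous_onI linear_continuous_on)
      (simp add: linear_conv_bounded_linear[symmetric])
  fix A assume "A \<in> sets (distr sphere_unif borel T)"
  then have A [measurable]: "A \<in> sets borel" by simp
  let ?B = "ball (0::real^'n) 1"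
  have TA: "T -` A \<in> sets borel"
    using measurable_sets[OF bT A] by simp
  have sgn_sets: "sgn -` C \<in> sets borel" if "C \<in> sets borel" for C :: "(real^'n) set"
    using measurable_sets[OF borel_measurable_sgn that] by simp
  have U: "emeasure sphere_unif C = emeasure lborel (?B \<inter> sgn -` C) / emeasure lborel ?B"
    if C: "C \<in> sets borel" for C
    unfolding sphere_unif_def using C sgn_sets[OF C]
    by (subst emeasure_distr) (auto intro!: emeasure_uniform_measure measurable_compose)
  have "sgn (T x) = T (sgn x)" for x
    using T lin by (simp add: sgn_div_norm orthogonal_transformation_norm linear_scale)
  then have "?B \<inter> sgn -` (T -` A) = T -` (?B \<inter> sgn -` A)"
    using T by (auto simp: orthogonal_transformation_norm)
  moreover have "emeasure lborel (T -` (?B \<inter> sgn -` A)) = emeasure lborel (?B \<inter> sgn -` A)"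
    using sgn_sets[OF A] by (intro emeasure_lborel_orthogonal_vimage[OF T]) auto
  ultimately show "emeasure (distr sphere_unif borel T) A = emeasure sphere_unif A"
    using U[OF A] U[OF TA] by (simp add: emeasure_distr)
qed simp


section \<open>Spherical cap discrepancy\<close>

definition halfspace :: "real^'n \<Rightarrow> real \<Rightarrow> (real^'n) set" where
  "halfspace w t = {y. w \<bullet> y \<ge> t}"

definition mu_emp :: "nat \<Rightarrow> (nat \<Rightarrow> real^'n) \<Rightarrow> real^'n \<Rightarrow> real \<Rightarrow> real" where
  "mu_emp N x w t = real (card {i \<in> {1..N}. x i \<in> halfspace w t}) / real N"

definition mu_cap :: "real^'n \<Rightarrow> real \<Rightarrow> real" where
  "mu_cap w t = measure sphere_unif (sphere 0 1 \<inter> halfspace w t)"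

definition disc_at :: "nat \<Rightarrow> (nat \<Rightarrow> real^'n) \<Rightarrow> real^'n \<Rightarrow> real \<Rightarrow> real" where
  "disc_at N x w t = \<bar>mu_emp N x w t - mu_cap w t\<bar>"

definition cap_discrepancy :: "nat \<Rightarrow> (nat \<Rightarrow> real^'n) \<Rightarrow> real" where
  "cap_discrepancy N x = (SUP (w, t) \<in> sphere 0 1 \<times> {-1..1}. disc_at N x w t)"


section \<open>Matrices with columns indexed by a finite set\<close>

text \<open>
  The number of columns of the matrices below varies with a finite set \<open>I\<close>, so it cannot be a type.
  A matrix with columns indexed by \<open>I\<close> is given by the family \<open>A\<close> of its columns and by \<open>I\<close>;
  a square matrix with rows and columns indexed by \<open>I\<close> is given by its entries \<open>M i j\<close>,
  of which only those with \<open>i\<close> and \<open>j\<close> in \<open>I\<close> matter.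
\<close>

definition rank_on :: "'i set \<Rightarrow> ('i \<Rightarrow> real^'m) \<Rightarrow> nat" where
  "rank_on I A = dim (A ` I)"

lemma rank_on_UNIV: "rank_on UNIV (\<lambda>i. column i A) = rank (A :: real^'i^'m)"
  by (simp add: rank_on_def column_rank_def columns_def full_SetCompr_eq)

text \<open>The entries of \<open>A\<^sup>T A\<close>.\<close>

definition gram :: "('i \<Rightarrow> real^'m) \<Rightarrow> 'i \<Rightarrow> 'i \<Rightarrow> real" where
  "gram A i j = A i \<bullet> A j"

text \<open>As for \<^const>\<open>matrix_inv\<close>, the value is unspecified if there is no inverse.\<close>

definition inverse_on :: "'i set \<Rightarrow> ('i \<Rightarrow> 'i \<Rightarrow> real) \<Rightarrow> 'i \<Rightarrow> 'i \<Rightarrow> real" where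
  "inverse_on I M = (SOME B. \<forall>i\<in>I. \<forall>j\<in>I.
     (\<Sum>k\<in>I. M i k * B k j) = (if i = j then 1 else 0) \<and>
     (\<Sum>k\<in>I. B i k * M k j) = (if i = j then 1 else 0))"

lemma inverse_on_UNIV:
  assumes "invertible (A :: real^'i^'i)"
  shows "inverse_on UNIV (\<lambda>i j. A $ i $ j) i j = matrix_inv A $ i $ j"
proof -
  let ?P = "\<lambda>B. \<forall>i\<in>UNIV. \<forall>j\<in>UNIV.
     (\<Sum>k\<in>UNIV. A $ i $ k * B k j) = (if i = j then 1 else 0) \<and>
     (\<Sum>k\<in>UNIV. B i k * A $ k $ j) = (if i = j then 1 else 0)"
  have *: "?P B \<longleftrightarrow> A ** (\<chi> i j. B i j) = mat 1 \<and> (\<chi> i j. B i j) ** A = mat 1" for B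
    by (auto simp: matrix_matrix_mult_def mat_def vec_eq_iff)
  have inv: "A ** matrix_inv A = mat 1" "matrix_inv A ** A = mat 1"
    using someI_ex[OF assms[unfolded invertible_def]] by (simp_all add: matrix_inv_def)
  have "?P (\<lambda>i j. matrix_inv A $ i $ j)"
    unfolding * using inv by (simp add: vec_lambda_eta)
  then have "?P (inverse_on UNIV (\<lambda>i j. A $ i $ j))"
    unfolding inverse_on_def by (rule someI[where P = ?P])
  then have "A ** (\<chi> i j. inverse_on UNIV (\<lambda>i j. A $ i $ j) i j) = mat 1"
    unfolding * by blast
  then have "(\<chi> i j. inverse_on UNIV (\<lambda>i j. A $ i $ j) i j) = matrix_inv A"
    by (metis inv(2) matrix_mul_assoc matrix_mul_lid matrix_mul_rid)
  then show ?thesis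
    by (metis vec_lambda_beta)
qed


section \<open>The quantities of the enumeration formula\<close>

text \<open>
  The columns of the matrix obtained from \<open>X\<close> by appending a row of entries \<open>-1\<close>; the additional
  row has the index \<^const>\<open>None\<close>.
\<close>

definition lifted :: "(nat \<Rightarrow> real^'n) \<Rightarrow> nat \<Rightarrow> real^('n option)" where
  "lifted x i = (\<chi> r. case r of None \<Rightarrow> -1 | Some k \<Rightarrow> x i $ k)"

text \<open>The \<open>i\<close>-th entry of the vector obtained by applying the inverse Gram matrix to the all-ones vector.\<close>

definition gram_inv_ones :: "(nat \<Rightarrow> real^'n) \<Rightarrow> nat set \<Rightarrow> nat \<Rightarrow> real" where
  "gram_inv_ones x I i = (\<Sum>j\<in>I. inverse_on I (gram (lifted x)) i j)"

definition gamma :: "(nat \<Rightarrow> real^'n) \<Rightarrow> nat set \<Rightarrow> real" where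
  "gamma x I = (\<Sum>i\<in>I. gram_inv_ones x I i)"

definition Phi1 :: "nat \<Rightarrow> (nat \<Rightarrow> real^'n) \<Rightarrow> nat set set" where
  "Phi1 N x = {I. I \<subseteq> {1..N} \<and> 1 \<le> rank_on I (lifted x) \<and> rank_on I (lifted x) = card I \<and>
     card I \<le> min CARD('n) (rank_on {1..N} (lifted x)) \<and> gamma x I < 1}"

definition Phi0 :: "nat \<Rightarrow> (nat \<Rightarrow> real^'n) \<Rightarrow> nat set set" where
  "Phi0 N x = {I. I \<subseteq> {1..N} \<and> 1 \<le> rank_on I (lifted x) \<and> rank_on I (lifted x) = card I \<and>
     card I = min CARD('n) (rank_on {1..N} (lifted x)) \<and> gamma x I = 1}"

definition t_of :: "(nat \<Rightarrow> real^'n) \<Rightarrow> nat set \<Rightarrow> real" where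
  "t_of x I = sqrt ((1 - gamma x I) / gamma x I)"

definition w_of :: "(nat \<Rightarrow> real^'n) \<Rightarrow> nat set \<Rightarrow> real^'n" where
  "w_of x I = ((1 + (t_of x I)\<^sup>2) / t_of x I) *\<^sub>R (\<Sum>i\<in>I. gram_inv_ones x I i *\<^sub>R x i)"

definition ker_transpose :: "(nat \<Rightarrow> real^'n) \<Rightarrow> nat set \<Rightarrow> (real^'n) set" where
  "ker_transpose x I = {w. \<forall>i\<in>I. w \<bullet> x i = 0}"

definition Delta1 :: "nat \<Rightarrow> (nat \<Rightarrow> real^'n) \<Rightarrow> real" where
  "Delta1 N x = (if Phi1 N x \<noteq> {} then
     Max ((\<lambda>I. max (disc_at N x (w_of x I) (t_of x I))
                   (disc_at N x (- w_of x I) (- t_of x I))) ` Phi1 N x)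
   else 0)"

definition Delta0 :: "nat \<Rightarrow> (nat \<Rightarrow> real^'n) \<Rightarrow> (nat set \<Rightarrow> real^'n) \<Rightarrow> real" where
  "Delta0 N x v = (if Phi0 N x \<noteq> {} then
     Max ((\<lambda>I. max (disc_at N x (v I) 0) (disc_at N x (- v I) 0)) ` Phi0 N x)
   else 0)"

end

theory Submission
  imports Defs
begin

text \<open>
  It suffices to bound the excesses \<open>card J / N - mu_cap w s\<close> of caps containing the points \<open>x i\<close>,
  \<open>i \<in> J\<close>. Since \<open>mu_cap w s\<close> is independent of the unit vector \<open>w\<close> and antitone in \<open>s\<close>, one may
  replace the cap by one with the largest \<open>t\<close> such that \<open>t \<le> w \<bullet> x i\<close> on \<open>J\<close> for some unit vector
  \<open>w\<close>. If \<open>t \<noteq> 0\<close>, the optimal \<open>w\<close> lies in the span of the points with \<open>w \<bullet> x i = t\<close>: otherwise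
  shrinking (for \<open>t > 0\<close>) or enlarging (for \<open>t < 0\<close>) the component orthogonal to them and normalising
  would increase \<open>t\<close>. A basis \<open>I\<close> of that span belongs to \<open>Phi1\<close> and has \<open>(w_I, t_I) = \<plusminus>(w, t)\<close>.
  If \<open>t = 0\<close>, take among the optimal \<open>w\<close> one with the most points on the hyperplane \<open>w \<bullet> y = 0\<close>.
  Optimality puts the last unit vector into the span of the lifted boundary points, so that a basis
  \<open>I\<close> of this span has \<open>gamma = 1\<close> and belongs to \<open>Phi0\<close>; its kernel vector is \<open>\<plusminus>w\<close>, unless all
  points lie on the hyperplane, in which case any kernel vector is as good.
\<close>

section \<open>Bases and Gram matrices\<close>

text \<open>The basis is selected through indices on which \<open>f\<close> is injective, so that
  repeated points of the family cannot spoil the count \<open>card I\<close>.\<close>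

lemma family_basis:
  fixes f :: "'i \<Rightarrow> 'a::euclidean_space"
  obtains I where "I \<subseteq> A" "independent (f ` I)" "inj_on f I" "span (f ` I) = span (f ` A)"
    "card I = dim (f ` A)"
proof -
  obtain C where C: "C \<subseteq> f ` A" "independent C" "f ` A \<subseteq> span C" "card C = dim (f ` A)"
    using basis_exists by blast
  then obtain I where I: "I \<subseteq> A" "inj_on f I" "C = f ` I"
    using subset_image_inj[of C f A] by auto
  moreover have "span (f ` I) = span (f ` A)"
    using C I by (metis span_eq span_superset order_trans)
  moreover have "card I = dim (f ` A)"
    using C(4) I by (simp add: card_image)
  ultimately show ?thesis using that C(2) by blast
qed

text \<open>The dimension is at most the number of distinct columns, which is at most
  \<open>card I\<close>; equality of the outer terms forces both conclusions.\<close>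

lemma independent_of_rank_on:
  assumes "rank_on I A = card I" "finite I"
  shows "independent (A ` I)" "inj_on A I"
proof -
  have "card I \<le> card (A ` I)"
    using assms dim_le_card'[of "A ` I"] by (simp add: rank_on_def)
  then have c: "card (A ` I) = card I"
    using card_image_le[OF assms(2), of A] by simp
  then show "inj_on A I" using assms(2) by (simp add: eq_card_imp_inj_on)
  show "independent (A ` I)"
    by (rule card_le_dim_spanning[of _ "A ` I"])
      (use assms c in \<open>auto simp: rank_on_def span_superset\<close>)
qed

lemma rank_on_independent:
  fixes A :: "'i \<Rightarrow> real^'m"
  assumes "independent (A ` I)" "inj_on A I"
  shows "rank_on I A = card I"
  using assms by (simp add: rank_on_def dim_eq_card_independent card_image)

lemma sum_scaleR_in_span_image:
  assumes "finite I" "v \<in> span (A ` I)" "inj_on A I"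
  obtains c where "v = (\<Sum>i\<in>I. c i *\<^sub>R A i)"
proof -
  obtain u where "v = (\<Sum>a\<in>A ` I. u a *\<^sub>R a)"
    using assms by (auto simp: span_finite)
  then have "v = (\<Sum>i\<in>I. u (A i) *\<^sub>R A i)"
    by (simp add: sum.reindex[OF assms(3)])
  then show ?thesis by (rule that)
qed

text \<open>The component \<open>z\<close> of \<open>A j\<close> orthogonal to the other vectors is
  nonzero by independence, and scaling it by \<open>1 / (z \<bullet> z)\<close> gives the dual
  vector.\<close>

lemma dual_vector_exists:
  fixes A :: "'i \<Rightarrow> real^'m"
  assumes "independent (A ` I)" "inj_on A I" "j \<in> I"
  shows "\<exists>b\<in>span (A ` I). \<forall>i\<in>I. A i \<bullet> b = (if i = j then 1 else 0)"
proof -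
  let ?S = "A ` (I - {j})"
  obtain y z where yz: "y \<in> span ?S" "\<And>v. v \<in> span ?S \<Longrightarrow> orthogonal z v" "A j = y + z"
    using orthogonal_subspace_decomp_exists[of ?S "A j"] by metis
  have "?S = A ` I - {A j}"
    using assms(2,3) by (auto simp: inj_on_def)
  then have "A j \<notin> span ?S"
    using assms(1,3) by (auto simp: dependent_def)
  then have z0: "z \<noteq> 0" using yz by auto
  have zs: "z \<in> span (A ` I)"
  proof -
    have "y \<in> span (A ` I)" using yz(1) span_mono[of ?S "A ` I"] by auto
    moreover have "A j \<in> span (A ` I)" using assms(3) by (simp add: span_base)
    ultimately show ?thesis using yz(3) span_diff by fastforce
  qed
  have *: "A i \<bullet> z = 0" if "i \<in> I" "i \<noteq> j" for i
    using yz(2)[of "A i"] that by (auto simp: span_base orthogonal_def inner_commute)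
  have "A j \<bullet> z = z \<bullet> z"
    using yz(2)[OF yz(1)] yz(3) by (simp add: inner_left_distrib inner_right_distrib orthogonal_def inner_commute[of y])
  then show ?thesis
    using * z0 zs by (intro bexI[of _ "(1 / (z \<bullet> z)) *\<^sub>R z"]) (auto simp: span_scale)
qed

text \<open>The Gram matrix of the dual vectors \<open>b j\<close> is a two-sided inverse, since the
  coefficient of \<open>A k\<close> in \<open>b j\<close> is \<open>b k \<bullet> b j\<close>. Hence
  the choice in \<open>inverse_on\<close> satisfies its equations.\<close>

lemma inverse_on_gram:
  fixes A :: "'i \<Rightarrow> real^'m"
  assumes "finite I" "independent (A ` I)" "inj_on A I"
  shows "\<forall>i\<in>I. \<forall>j\<in>I.
    (\<Sum>k\<in>I. gram A i k * inverse_on I (gram A) k j) = (if i = j then 1 else 0) \<and>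
    (\<Sum>k\<in>I. inverse_on I (gram A) i k * gram A k j) = (if i = j then 1 else 0)"
proof -
  obtain b where b: "\<And>j. j \<in> I \<Longrightarrow> b j \<in> span (A ` I)"
    "\<And>i j. i \<in> I \<Longrightarrow> j \<in> I \<Longrightarrow> A i \<bullet> b j = (if i = j then 1 else 0)"
    using dual_vector_exists[OF assms(2,3)] by metis
  define B where "B i j = b i \<bullet> b j" for i j
  have right: "(\<Sum>k\<in>I. gram A i k * B k j) = (if i = j then 1 else 0)"
    if ij: "i \<in> I" "j \<in> I" for i j
  proof -
    obtain c where c: "b j = (\<Sum>k\<in>I. c k *\<^sub>R A k)"
      using sum_scaleR_in_span_image[OF assms(1) b(1) assms(3)] ij by metis
    have "B k j = c k" if k: "k \<in> I" for k
    proof -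
      have "B k j = (\<Sum>l\<in>I. c l * (A l \<bullet> b k))"
        by (simp add: B_def c inner_sum_right inner_commute)
      also have "\<dots> = (\<Sum>l\<in>I. if l = k then c l else 0)"
        using k by (intro sum.cong) (auto simp: b(2))
      finally show ?thesis using k assms(1) by simp
    qed
    then have "(\<Sum>k\<in>I. gram A i k * B k j) = (\<Sum>k\<in>I. A i \<bullet> (c k *\<^sub>R A k))"
      by (intro sum.cong) (simp_all add: gram_def)
    also have "\<dots> = A i \<bullet> b j" by (simp add: c inner_sum_right)
    finally show ?thesis using b(2) ij by simp
  qed
  have left: "(\<Sum>k\<in>I. B i k * gram A k j) = (if i = j then 1 else 0)"
    if ij: "i \<in> I" "j \<in> I" for i j
  proof -
    have "(\<Sum>k\<in>I. B i k * gram A k j) = (\<Sum>k\<in>I. gram A j k * B k i)"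
      by (intro sum.cong) (simp_all add: B_def gram_def inner_commute mult.commute)
    then show ?thesis using right[OF ij(2,1)] by auto
  qed
  show ?thesis
    unfolding inverse_on_def by (rule someI[of _ B]) (use left right in blast)
qed

lemma gram_inv_ones_solves:
  assumes "finite I" "independent (lifted x ` I)" "inj_on (lifted x) I" "i \<in> I"
  shows "(\<Sum>j\<in>I. gram (lifted x) i j * gram_inv_ones x I j) = 1"
proof -
  have "(\<Sum>j\<in>I. gram (lifted x) i j * gram_inv_ones x I j) =
    (\<Sum>k\<in>I. \<Sum>j\<in>I. gram (lifted x) i j * inverse_on I (gram (lifted x)) j k)"
    unfolding gram_inv_ones_def sum_distrib_left by (rule sum.swap)
  also have "\<dots> = (\<Sum>k\<in>I. if i = k then 1 else 0)"
    using inverse_on_gram[OF assms(1-3)] assms(4) by (intro sum.cong) auto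
  finally show ?thesis using assms by simp
qed

text \<open>Apply the left inverse to the system. This is how \<open>gram_inv_ones\<close> is
  evaluated below: it suffices to exhibit any vector that the Gram matrix maps to a constant
  one.\<close>

lemma gram_inv_ones_unique:
  assumes "finite I" "independent (lifted x ` I)" "inj_on (lifted x) I" "i \<in> I"
    and sol: "\<And>j. j \<in> I \<Longrightarrow> (\<Sum>i\<in>I. gram (lifted x) j i * c i) = r"
  shows "c i = r * gram_inv_ones x I i"
proof -
  let ?B = "inverse_on I (gram (lifted x))" and ?G = "gram (lifted x)"
  have "c i = (\<Sum>j\<in>I. (if i = j then 1 else 0) * c j)"
    using assms(1,4) by (simp add: if_distrib[of "\<lambda>t. t * _"] cong: if_cong)
  also have "\<dots> = (\<Sum>j\<in>I. (\<Sum>k\<in>I. ?B i k * ?G k j) * c j)"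
    using inverse_on_gram[OF assms(1-3)] assms(4) by (intro sum.cong) auto
  also have "\<dots> = (\<Sum>k\<in>I. ?B i k * (\<Sum>j\<in>I. ?G k j * c j))"
    by (simp add: sum_distrib_left sum_distrib_right mult.assoc) (rule sum.swap)
  also have "\<dots> = (\<Sum>k\<in>I. ?B i k * r)"
    using sol by simp
  finally show ?thesis
    by (simp add: gram_inv_ones_def sum_distrib_left mult.commute)
qed

text \<open>Besides lifted points, whose last entry is -1, normals \<open>(w, 0)\<close> and the
  last unit vector \<open>lift_vec 0 1\<close> are needed in the same space.\<close>

definition lift_vec :: "real^'n \<Rightarrow> real \<Rightarrow> real^('n option)" where
  "lift_vec y s = (\<chi> r. case r of None \<Rightarrow> s | Some k \<Rightarrow> y $ k)"

lemma lifted_eq: "lifted x i = lift_vec (x i) (-1)"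
  by (simp add: lifted_def lift_vec_def)

lemma inner_lift_vec: "lift_vec y s \<bullet> lift_vec z r = y \<bullet> z + s * r"
  by (simp add: lift_vec_def inner_vec_def UNIV_option_conv sum.reindex)

lemma lift_vec_cases:
  obtains y s where "z = lift_vec y s"
proof
  show "z = lift_vec (\<chi> k. z $ Some k) (z $ None)"
    by (auto simp: lift_vec_def vec_eq_iff split: option.split)
qed

lemma lift_vec_eq_iff [simp]: "lift_vec y s = lift_vec z r \<longleftrightarrow> y = z \<and> s = r"
  by (auto simp: lift_vec_def vec_eq_iff split: option.splits)

lemma sum_lifted:
  "(\<Sum>i\<in>I. c i *\<^sub>R lifted x i) = lift_vec (\<Sum>i\<in>I. c i *\<^sub>R x i) (- (\<Sum>i\<in>I. c i))"
  by (auto simp: lifted_def lift_vec_def vec_eq_iff sum_negf split: option.split)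

lemma gram_lifted: "gram (lifted x) i j = x i \<bullet> x j + 1"
  by (simp add: gram_def lifted_eq inner_lift_vec)

lemma sum_gram_lifted:
  "(\<Sum>j\<in>I. gram (lifted x) i j * c j) = x i \<bullet> (\<Sum>j\<in>I. c j *\<^sub>R x j) + (\<Sum>j\<in>I. c j)"
  by (simp add: gram_lifted algebra_simps sum.distrib inner_sum_right)

lemma lift_eq_0: "lift_vec y s = 0 \<longleftrightarrow> y = 0 \<and> s = 0"
  by (auto simp: lift_vec_def vec_eq_iff split: option.splits)

text \<open>Dropping the last coordinate turns a linear relation among lifted points into one among
  the points.\<close>

lemma independent_lifted:
  assumes "finite I" "independent (x ` I)" "inj_on x I"
  shows "independent (lifted x ` I)" "inj_on (lifted x) I"
proof -
  show inj: "inj_on (lifted x) I"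
    using assms(3) by (auto simp: inj_on_def lifted_eq)
  show "independent (lifted x ` I)"
  proof (rule independent_if_scalars_zero)
    show "finite (lifted x ` I)" using assms(1) by simp
    fix f z assume "(\<Sum>z\<in>lifted x ` I. f z *\<^sub>R z) = 0" and z: "z \<in> lifted x ` I"
    then have "(\<Sum>i\<in>I. f (lifted x i) *\<^sub>R lifted x i) = 0"
      by (simp add: sum.reindex[OF inj])
    then have "(\<Sum>i\<in>I. f (lifted x i) *\<^sub>R x i) = 0"
      by (simp add: sum_lifted lift_eq_0)
    then have "(\<Sum>y\<in>x ` I. f (lifted x (the_inv_into I x y)) *\<^sub>R y) = 0"
      by (simp add: sum.reindex[OF assms(3)] the_inv_into_f_f[OF assms(3)])
    then have 0: "f (lifted x (the_inv_into I x y)) = 0" if "y \<in> x ` I" for y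
      using independentD[OF assms(2) finite_imageI[OF assms(1)] subset_refl _ that] by simp
    obtain i where "i \<in> I" "z = lifted x i" using z by blast
    then show "f z = 0"
      using 0[of "x i"] the_inv_into_f_f[OF assms(3)] by simp
  qed
qed

text \<open>Pairing \<open>w\<close> with itself gives \<open>sum c I = 1 / s\<close>, so the Gram
  matrix maps \<open>c\<close> to the constant \<open>s + 1 / s\<close>. Thus \<open>c\<close> is a
  multiple of \<open>gram_inv_ones\<close> and \<open>gamma x I = 1 / (1 + s^2)\<close>, from which
  \<open>s\<close> and \<open>w\<close> are recovered.\<close>

lemma unit_vector_of_equidistant:
  assumes "finite I" "independent (lifted x ` I)" "inj_on (lifted x) I"
    and w: "w = (\<Sum>i\<in>I. c i *\<^sub>R x i)" "norm w = 1" and s: "s > 0" "\<And>i. i \<in> I \<Longrightarrow> w \<bullet> x i = s"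
  shows "gamma x I < 1" "t_of x I = s" "w_of x I = w"
proof -
  have "1 = w \<bullet> w" using w(2) by (simp add: norm_eq_sqrt_inner)
  also have "\<dots> = (\<Sum>i\<in>I. c i * s)"
    by (subst (2) w(1)) (simp add: inner_sum_right s(2))
  finally have c: "sum c I = 1 / s"
    unfolding sum_distrib_right[symmetric] using s(1) by (simp add: field_simps)
  have g: "gram_inv_ones x I i = s / (1 + s\<^sup>2) * c i" if "i \<in> I" for i
  proof -
    have "c i = (s + 1 / s) * gram_inv_ones x I i"
      by (rule gram_inv_ones_unique[OF assms(1-3) that])
        (simp add: sum_gram_lifted c w(1)[symmetric], metis inner_commute s(2))
    moreover have "s + 1 / s = (1 + s\<^sup>2) / s" using s(1) by (simp add: field_simps power2_eq_square)
    moreover have "1 + s\<^sup>2 > 0" by (simp add: add_pos_nonneg)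
    ultimately show ?thesis using s(1) by (simp add: field_simps)
  qed
  have gam: "gamma x I = 1 / (1 + s\<^sup>2)"
  proof -
    have "gamma x I = (\<Sum>i\<in>I. s / (1 + s\<^sup>2) * c i)"
      unfolding gamma_def using g by (rule sum.cong[OF refl])
    then show ?thesis using s(1) by (simp only: sum_distrib_left[symmetric] c) simp
  qed
  have pos: "1 + s\<^sup>2 > 0" by (simp add: add_pos_nonneg)
  show "gamma x I < 1" using s(1) pos by (simp add: gam)
  have "(1 - gamma x I) / gamma x I = s\<^sup>2" using pos by (simp add: gam field_simps)
  then show t: "t_of x I = s" using s(1) by (simp add: t_of_def)
  have "(\<Sum>i\<in>I. gram_inv_ones x I i *\<^sub>R x i) = (s / (1 + s\<^sup>2)) *\<^sub>R w"
    by (simp add: w(1) scaleR_sum_right g)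
  then show "w_of x I = w"
    using s(1) pos by (simp add: w_of_def t)
qed

text \<open>\<open>gamma x I\<close> is the squared norm of the projection of the last unit vector onto the span of the
  lifted points.\<close>

lemma gamma_eq_1:
  assumes "finite I" "independent (lifted x ` I)" "inj_on (lifted x) I"
    and "lift_vec 0 1 \<in> span (lifted x ` I)"
  shows "gamma x I = 1"
proof -
  obtain a where a: "lift_vec 0 1 = (\<Sum>i\<in>I. a i *\<^sub>R lifted x i)"
    using sum_scaleR_in_span_image[OF assms(1,4,3)] by blast
  then have *: "(\<Sum>i\<in>I. a i *\<^sub>R x i) = 0" "(\<Sum>i\<in>I. a i) = -1"
    by (simp_all add: sum_lifted)
  have "a i = -1 * gram_inv_ones x I i" if "i \<in> I" for i
    by (rule gram_inv_ones_unique[OF assms(1-3) that]) (simp add: sum_gram_lifted *)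
  then have "gram_inv_ones x I i = - a i" if "i \<in> I" for i using that by simp
  then show ?thesis using *(2) by (simp add: gamma_def sum_negf)
qed

text \<open>This makes the caps of \<open>Phi1\<close> admissible in the supremum. The vector
  \<open>p\<close> has inner product \<open>1 - g\<close> with each point and squared norm
  \<open>g * (1 - g)\<close>. Cauchy-Schwarz with one unit point forces
  \<open>1 - g \<le> g\<close>, hence \<open>t \<le> 1\<close>; and \<open>1 + t^2 = 1 / g\<close>
  yields norm one.\<close>

lemma unit_vector_of_Phi1:
  fixes x :: "nat \<Rightarrow> real^'n"
  assumes I: "I \<in> Phi1 N x" and x: "\<And>i. i \<in> {1..N} \<Longrightarrow> x i \<in> sphere 0 1"
  shows "w_of x I \<in> sphere 0 1" "t_of x I \<in> {-1..1}"
proof -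
  have fin: "finite I" "I \<subseteq> {1..N}" and rk: "rank_on I (lifted x) = card I" and ge1: "card I \<ge> 1"
    and lt: "gamma x I < 1"
    using I finite_subset[of I "{1..N}"] by (auto simp: Phi1_def)
  note indep = fin(1) independent_of_rank_on[OF rk fin(1)]
  define g p where "g = gamma x I" and "p = (\<Sum>i\<in>I. gram_inv_ones x I i *\<^sub>R x i)"
  have px: "x i \<bullet> p = 1 - g" if "i \<in> I" for i
    using gram_inv_ones_solves[OF indep that] by (simp add: sum_gram_lifted p_def g_def gamma_def)
  have pp: "p \<bullet> p = g * (1 - g)"
    by (subst p_def) (simp add: inner_sum_left px g_def gamma_def sum_distrib_right)
  obtain i where i: "i \<in> I" using ge1 by (metis card.empty ex_in_conv not_one_le_zero)
  have "norm (x i) = 1" using x i fin(2) by auto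
  then have "1 - g \<le> norm p" using norm_cauchy_schwarz[of "x i" p] px[OF i] by simp
  then have "(1 - g)\<^sup>2 \<le> (norm p)\<^sup>2" using lt by (intro power_mono) (simp_all add: g_def)
  also have "\<dots> = g * (1 - g)" by (simp add: power2_norm_eq_inner pp)
  finally have "(1 - g) * (1 - g) \<le> g * (1 - g)" by (simp add: power2_eq_square)
  then have g2: "1 - g \<le> g" using lt by (simp add: g_def mult_le_cancel_right)
  then have g0: "0 < g" using lt g_def by linarith
  define t where "t = t_of x I"
  have t2: "t\<^sup>2 = (1 - g) / g" using g0 lt by (simp add: t_def t_of_def g_def)
  have t0: "t > 0" using g0 lt by (simp add: t_def t_of_def g_def)
  have "t\<^sup>2 \<le> 1" using g2 g0 by (simp add: t2)
  then have "t \<le> 1" by (simp add: power2_le_iff_abs_le[of 1] power_le_one_iff abs_square_le_1)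
  then show "t_of x I \<in> {-1..1}" using t0 by (simp add: t_def)
  have "(norm (w_of x I))\<^sup>2 = ((1 + t\<^sup>2) / t)\<^sup>2 * (p \<bullet> p)"
    by (simp add: w_of_def t_def[symmetric] p_def[symmetric] power_mult_distrib
        power2_norm_eq_inner power_divide)
  also have "\<dots> = (1 / g)\<^sup>2 / t\<^sup>2 * (g * (1 - g))"
    using g0 by (simp add: pp t2 power_divide) (simp add: field_simps)
  also have "\<dots> = 1"
    using g0 lt unfolding t2 by (simp add: g_def power2_eq_square)
  finally show "w_of x I \<in> sphere 0 1"
    by (simp add: abs_square_eq_1)
qed


section \<open>Caps of maximal height\<close>

lemma halfspace_borel: "sphere 0 1 \<inter> halfspace w t \<in> sets (borel :: (real^'n) measure)"
  unfolding halfspace_def by (intro sets.Int borel_closed closed_halfspace_ge) simp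

lemma mu_cap_bounds: "0 \<le> mu_cap w t" "mu_cap w t \<le> 1"
  by (simp_all add: mu_cap_def prob_space.prob_le_1[OF prob_space_sphere_unif])

text \<open>An orthogonal map taking \<open>w\<close> to \<open>w'\<close> carries one cap onto the
  other and preserves \<open>sphere_unif\<close>. Caps with different centres can therefore be
  compared by their heights alone.\<close>

lemma mu_cap_rotate:
  fixes w w' :: "real^'n"
  assumes "norm w = 1" "norm w' = 1"
  shows "mu_cap w t = mu_cap w' t"
proof -
  obtain T where T: "orthogonal_transformation T" "T w = w'"
    using orthogonal_transformation_exists_1[OF assms] by blast
  have bT: "T \<in> borel_measurable borel"
    using T(1) by (intro borel_measurable_continuous_onI linear_continuous_on)
      (simp add: linear_conv_bounded_linear[symmetric] orthogonal_transformation_linear)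
  have "w' \<bullet> T y = w \<bullet> y" for y
    using T by (auto simp: orthogonal_transformation_def)
  then have pre: "T -` (sphere 0 1 \<inter> halfspace w' t) = sphere 0 1 \<inter> halfspace w t"
    using T(1) by (auto simp: halfspace_def orthogonal_transformation_norm)
  have "mu_cap w' t = measure (distr sphere_unif borel T) (sphere 0 1 \<inter> halfspace w' t)"
    by (simp add: mu_cap_def sphere_unif_invariant[OF T(1)])
  also have "\<dots> = measure sphere_unif (T -` (sphere 0 1 \<inter> halfspace w' t) \<inter> space sphere_unif)"
    by (rule measure_distr) (use bT halfspace_borel in \<open>simp_all cong: measurable_cong_sets\<close>)
  finally show ?thesis
    by (simp only: mu_cap_def pre space_sphere_unif Int_UNIV_right)
qed

lemma mu_cap_antimono:
  fixes w :: "real^'n"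
  assumes "s \<le> t"
  shows "mu_cap w t \<le> mu_cap w s"
proof -
  interpret prob_space "sphere_unif :: (real^'n) measure" by (rule prob_space_sphere_unif)
  show ?thesis unfolding mu_cap_def
    by (rule finite_measure_mono) (use assms halfspace_borel in \<open>auto simp: halfspace_def\<close>)
qed

text \<open>The two caps are disjoint because \<open>s < t\<close> is strict: the first lies in
  \<open>w \<bullet> y \<le> s\<close>.\<close>

lemma mu_cap_opposite:
  fixes w :: "real^'n"
  assumes "s < t"
  shows "mu_cap (- w) (- s) + mu_cap w t \<le> 1"
proof -
  interpret prob_space "sphere_unif :: (real^'n) measure" by (rule prob_space_sphere_unif)
  have "mu_cap (- w) (- s) + mu_cap w t =
    prob ((sphere 0 1 \<inter> halfspace (- w) (- s)) \<union> (sphere 0 1 \<inter> halfspace w t))"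
    unfolding mu_cap_def
    by (rule finite_measure_Union[symmetric]) (use assms halfspace_borel in \<open>auto simp: halfspace_def\<close>)
  then show ?thesis by simp
qed

lemma mu_emp_bounds: "0 \<le> mu_emp N x w t" "mu_emp N x w t \<le> 1"
proof -
  have "card {i \<in> {1..N}. x i \<in> halfspace w t} \<le> card {1..N}"
    by (rule card_mono) auto
  then show "0 \<le> mu_emp N x w t" "mu_emp N x w t \<le> 1"
    by (cases "N = 0"; simp add: mu_emp_def divide_le_eq_1)+
qed

lemma disc_at_le_1: "disc_at N x w t \<le> 1"
  using mu_emp_bounds[of N x w t] mu_cap_bounds[of w t] by (simp add: disc_at_def abs_le_iff)

text \<open>
  A deficit of points in a closed cap is an excess in the complementary open cap, and then also in the
  smallest closed cap with the same centre and the same points. So only excesses matter, and no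
  continuity of \<open>mu_cap w\<close> is needed, which fails in dimension one.
\<close>

lemma disc_at_le_excess:
  fixes x :: "nat \<Rightarrow> real^'n"
  assumes N: "N \<ge> 1" and x: "\<And>i. i \<in> {1..N} \<Longrightarrow> norm (x i) = 1"
    and w: "norm w = 1" and t: "t \<in> {-1..1}" and pos: "disc_at N x w t > 0"
  obtains w' s J where "norm w' = 1" "s \<in> {-1..1}" "J \<subseteq> {1..N}" "J \<noteq> {}"
    "\<And>i. i \<in> J \<Longrightarrow> s \<le> w' \<bullet> x i" "disc_at N x w t \<le> card J / N - mu_cap w' s"
proof (cases "mu_cap w t \<le> mu_emp N x w t")
  case True
  let ?J = "{i \<in> {1..N}. x i \<in> halfspace w t}"
  have d: "disc_at N x w t = card ?J / N - mu_cap w t"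
    using True by (simp add: disc_at_def mu_emp_def)
  show ?thesis
  proof (rule that[of w t ?J])
    show "?J \<noteq> {}" using d pos mu_cap_bounds(1)[of w t] by (metis card.empty of_nat_0 div_0 diff_gt_0_iff_gt not_le)
  qed (use w t d in \<open>auto simp: halfspace_def\<close>)
next
  case False
  let ?J = "{i \<in> {1..N}. w \<bullet> x i < t}"
  have Jeq: "?J = {1..N} - {i \<in> {1..N}. x i \<in> halfspace w t}" by (auto simp: halfspace_def)
  have "card ?J = card {1..N} - card {i \<in> {1..N}. x i \<in> halfspace w t}"
    unfolding Jeq by (rule card_Diff_subset) auto
  moreover have "card {i \<in> {1..N}. x i \<in> halfspace w t} \<le> card {1..N}"
    by (rule card_mono) auto
  ultimately have "mu_emp N x w t = 1 - card ?J / N"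
    using N by (simp add: mu_emp_def of_nat_diff field_simps)
  then have d: "disc_at N x w t = card ?J / N - (1 - mu_cap w t)"
    using False by (simp add: disc_at_def)
  have ne: "?J \<noteq> {}"
  proof
    assume "?J = {}"
    then show False using d pos mu_cap_bounds(2)[of w t] by (simp only: card.empty)
  qed
  \<comment> \<open>The greatest height among the points outside the cap. The opposite cap
    \<open>w \<bullet> y \<le> s\<close> contains all of these points and is disjoint from the given
    cap.\<close>
  define s where "s = Max ((\<lambda>i. w \<bullet> x i) ` ?J)"
  have "s \<in> (\<lambda>i. w \<bullet> x i) ` ?J"
    unfolding s_def by (rule Max_in) (use ne in auto)
  then obtain k where k: "k \<in> ?J" "s = w \<bullet> x k" by blast
  have st: "s < t" using k by simp
  have "\<bar>s\<bar> \<le> 1" using Cauchy_Schwarz_ineq2[of w "x k"] k w x by simp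
  then have "- s \<in> {-1..1}" by auto
  moreover have "- s \<le> (- w) \<bullet> x i" if "i \<in> ?J" for i
    using that by (simp add: s_def)
  moreover have "disc_at N x w t \<le> card ?J / N - mu_cap (- w) (- s)"
    using mu_cap_opposite[OF st, of w] d by simp
  ultimately show ?thesis
    by (intro that[of "- w" "- s" ?J] ne) (use w in auto)
qed

section \<open>Optimal half-spaces\<close>

lemma optimal_halfspace_exists:
  fixes x :: "'i \<Rightarrow> 'a::euclidean_space"
  assumes J: "finite J" "J \<noteq> {}" and x: "\<And>i. i \<in> J \<Longrightarrow> norm (x i) = 1"
    and w0: "norm w0 = 1" "s \<in> {-1..1}" "\<And>i. i \<in> J \<Longrightarrow> s \<le> w0 \<bullet> x i"
  obtains w t where "norm w = 1" "s \<le> t" "t \<in> {-1..1}" "\<And>i. i \<in> J \<Longrightarrow> t \<le> w \<bullet> x i"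
    "\<And>y. \<exists>i\<in>J. y \<bullet> x i \<le> t * norm y"
proof -
  define C where "C = (sphere 0 1 \<times> {-1..1}) \<inter> (\<Inter>i\<in>J. {p. snd p \<le> fst p \<bullet> x i})"
  have "compact C" unfolding C_def
    by (intro compact_Int_closed compact_Times compact_sphere compact_Icc closed_INT ballI
        closed_Collect_le continuous_intros)
  moreover have w0C: "(w0, s) \<in> C" using w0 by (auto simp: C_def)
  ultimately have "\<exists>p\<in>C. \<forall>q\<in>C. snd q \<le> snd p"
    by (intro continuous_attains_sup continuous_on_snd continuous_on_id) auto
  then obtain p where p: "p \<in> C" "\<And>q. q \<in> C \<Longrightarrow> snd q \<le> snd p"
    by blast
  obtain w t where wt: "p = (w, t)" by (cases p)
  \<comment> \<open>Optimality is put in homogeneous form, so that later perturbations of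
    \<open>w\<close> need not be normalised. If it failed at \<open>y\<close>, the normalised
    \<open>y\<close> would admit the height \<open>r > t\<close>, against maximality in the compact
    set \<open>C\<close>.\<close>
  have opt: "\<exists>i\<in>J. y \<bullet> x i \<le> t * norm y" for y
  proof (rule ccontr)
    assume "\<not> ?thesis"
    then have y: "\<And>i. i \<in> J \<Longrightarrow> t * norm y < y \<bullet> x i" by auto
    have "y \<noteq> 0" using y J(2) by auto
    then have ny: "norm y > 0" by simp
    define r where "r = Min ((\<lambda>i. y \<bullet> x i / norm y) ` J)"
    have "r \<in> (\<lambda>i. y \<bullet> x i / norm y) ` J"
      unfolding r_def by (rule Min_in) (use J in auto)
    then obtain k where k: "k \<in> J" "r = y \<bullet> x k / norm y" by blast
    have "t < r" using k y[OF k(1)] ny by (simp add: pos_less_divide_eq)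
    moreover have "r \<le> 1"
      using norm_cauchy_schwarz[of y "x k"] k x[OF k(1)] ny by (simp add: divide_le_eq_1)
    moreover have "r \<le> (1 / norm y) *\<^sub>R y \<bullet> x i" if "i \<in> J" for i
      using that J(1) by (auto simp: r_def intro!: Min_le)
    ultimately have "((1 / norm y) *\<^sub>R y, r) \<in> C"
      using ny p(1) by (auto simp: C_def wt)
    then have "r \<le> t" using p(2) wt by fastforce
    then show False using \<open>t < r\<close> by simp
  qed
  show ?thesis
    using that[of w t] opt p(1) p(2)[OF w0C] by (auto simp: C_def wt)
qed

text \<open>Both sides are continuous in \<open>e\<close> and there are finitely many constraints,
  so the points strictly inside a cap remain strictly inside under a small tilt.\<close>

lemma eventually_inner_gt_perturbed:
  fixes x :: "'i \<Rightarrow> 'a::real_inner"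
  assumes "finite K" "\<And>i. i \<in> K \<Longrightarrow> t * norm w < w \<bullet> x i"
  shows "\<forall>\<^sub>F e in at_right 0. \<forall>i\<in>K. t * norm (w + e *\<^sub>R u) < (w + e *\<^sub>R u) \<bullet> x i"
proof (rule eventually_ball_finite[OF assms(1)], rule ballI)
  fix i assume i: "i \<in> K"
  have "((\<lambda>e. (w + e *\<^sub>R u) \<bullet> x i - t * norm (w + e *\<^sub>R u)) \<longlongrightarrow>
      (w + 0 *\<^sub>R u) \<bullet> x i - t * norm (w + 0 *\<^sub>R u)) (at_right 0)"
    by (intro tendsto_intros)
  then have "\<forall>\<^sub>F e in at_right 0. 0 < (w + e *\<^sub>R u) \<bullet> x i - t * norm (w + e *\<^sub>R u)"
    by (rule order_tendstoD) (use assms(2)[OF i] in simp)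
  then show "\<forall>\<^sub>F e in at_right 0. t * norm (w + e *\<^sub>R u) < (w + e *\<^sub>R u) \<bullet> x i"
    by eventually_elim simp
qed

lemma optimal_in_span_active:
  fixes x :: "'i \<Rightarrow> 'a::euclidean_space"
  assumes J: "finite J" and w: "norm w = 1" "\<And>i. i \<in> J \<Longrightarrow> t \<le> w \<bullet> x i"
    and opt: "\<And>y. \<exists>i\<in>J. y \<bullet> x i \<le> t * norm y" and t: "t \<noteq> 0"
  shows "w \<in> span (x ` {i \<in> J. w \<bullet> x i = t})"
proof (rule ccontr)
  let ?A = "{i \<in> J. w \<bullet> x i = t}"
  assume notin: "w \<notin> span (x ` ?A)"
  obtain a b where ab: "a \<in> span (x ` ?A)" "\<And>v. v \<in> span (x ` ?A) \<Longrightarrow> orthogonal b v" "w = a + b"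
    by (rule orthogonal_subspace_decomp_exists[of "x ` ?A" w]) (rule that)
  \<comment> \<open>Moving along \<open>b\<close> leaves the inner products with the active points
    equal to \<open>t\<close>. The sign is chosen so that the norm decreases for positive
    \<open>t\<close> and increases for negative \<open>t\<close>; either way \<open>t * norm\<close>
    drops below \<open>t\<close>.\<close>
  define u where "u = - sgn t *\<^sub>R b"
  have "b \<noteq> 0" using notin ab by auto
  then have bb: "b \<bullet> b > 0" by simp
  have wb: "w \<bullet> b = b \<bullet> b"
    using ab(2)[OF ab(1)] ab(3) by (simp add: inner_left_distrib inner_right_distrib orthogonal_def inner_commute[of a])
  have "\<forall>\<^sub>F e in at_right 0. \<forall>i\<in>{i \<in> J. t < w \<bullet> x i}. t * norm (w + e *\<^sub>R u) < (w + e *\<^sub>R u) \<bullet> x i"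
    by (rule eventually_inner_gt_perturbed) (use J w in auto)
  \<comment> \<open>The squared norm changes by a positive multiple of
    \<open>e^2 - 2 * e * sgn t\<close>, which for positive \<open>t\<close> is negative exactly when
    \<open>0 < e < 2\<close>.\<close>
  moreover have "\<forall>\<^sub>F e in at_right (0::real). 0 < e \<and> e < 2"
    by (rule eventually_at_rightI[of 0 2]) auto
  ultimately obtain e where e: "0 < e" "e < 2"
    and K: "\<And>i. i \<in> J \<Longrightarrow> t < w \<bullet> x i \<Longrightarrow> t * norm (w + e *\<^sub>R u) < (w + e *\<^sub>R u) \<bullet> x i"
    using eventually_happens'[OF trivial_limit_at_right_real eventually_conj] by blast
  have sq: "(norm (w + e *\<^sub>R u))\<^sup>2 = 1 + (e\<^sup>2 - 2 * e * sgn t) * (b \<bullet> b)"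
  proof -
    have "sgn t * sgn t = 1" using t by (simp add: sgn_if)
    then have uu: "u \<bullet> u = b \<bullet> b" by (simp add: u_def)
    have wu: "w \<bullet> u = - sgn t * (b \<bullet> b)" by (simp add: u_def wb)
    have "w \<bullet> w = 1" using w(1) by (simp add: norm_eq_sqrt_inner)
    then show ?thesis
      by (simp add: power2_norm_eq_inner inner_left_distrib inner_right_distrib inner_commute[of u w]
          uu wu) (simp add: algebra_simps power2_eq_square)
  qed
  have tn: "t * norm (w + e *\<^sub>R u) < t"
  proof (cases "t > 0")
    case True
    then have "e\<^sup>2 - 2 * e * sgn t < 0" using e by (simp add: power2_eq_square)
    then have "(norm (w + e *\<^sub>R u))\<^sup>2 < 1\<^sup>2" using bb sq by (simp add: mult_neg_pos)
    then have "norm (w + e *\<^sub>R u) < 1" by (rule power2_less_imp_less) simp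
    then show ?thesis using True by simp
  next
    case False
    then have "e\<^sup>2 - 2 * e * sgn t > 0" using e t by (simp add: sgn_if add_pos_pos)
    then have "1\<^sup>2 < (norm (w + e *\<^sub>R u))\<^sup>2" using bb sq by simp
    then have "1 < norm (w + e *\<^sub>R u)" by (rule power2_less_imp_less) simp
    then show ?thesis using False t by (simp add: mult_less_cancel_left1)
  qed
  have "t * norm (w + e *\<^sub>R u) < (w + e *\<^sub>R u) \<bullet> x i" if i: "i \<in> J" for i
  proof (cases "w \<bullet> x i = t")
    case True
    then have "b \<bullet> x i = 0" using ab(2)[of "x i"] i by (auto simp: orthogonal_def span_base)
    then show ?thesis using True tn by (simp add: inner_diff_left u_def)
  next
    case False
    then show ?thesis using K[OF i] w(2)[OF i] by simp
  qed
  then show False using opt[of "w + e *\<^sub>R u"] by (meson not_le)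
qed


section \<open>Optimal caps and the families of index sets\<close>

lemma optimal_in_Phi1:
  fixes x :: "nat \<Rightarrow> real^'n"
  assumes J: "J \<subseteq> {1..N}" and w: "norm w = 1" "\<And>i. i \<in> J \<Longrightarrow> t \<le> w \<bullet> x i"
    and opt: "\<And>y. \<exists>i\<in>J. y \<bullet> x i \<le> t * norm y" and t: "t \<noteq> 0"
  obtains I where "I \<in> Phi1 N x" "(w_of x I, t_of x I) = (w, t) \<or> (w_of x I, t_of x I) = (- w, - t)"
proof -
  let ?A = "{i \<in> J. w \<bullet> x i = t}"
  have finJ: "finite J" using J finite_subset by blast
  have wA: "w \<in> span (x ` ?A)" by (rule optimal_in_span_active[OF finJ w opt t])
  \<comment> \<open>The basis is taken among the points rather than their lifts: this bounds
    \<open>card I\<close> by the dimension \<open>n\<close>, and independence passes to the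
    lifts.\<close>
  obtain I where I: "I \<subseteq> ?A" "independent (x ` I)" "inj_on x I" "span (x ` I) = span (x ` ?A)"
    "card I = dim (x ` ?A)" by (rule family_basis)
  have finI: "finite I" using I(1) finJ by (auto intro: finite_subset)
  note indep = independent_lifted[OF finI I(2,3)]
  obtain c where c: "w = (\<Sum>i\<in>I. c i *\<^sub>R x i)"
    using sum_scaleR_in_span_image[OF finI _ I(3)] wA I(4) by metis
  have inI: "w \<bullet> x i = t" if "i \<in> I" for i using I(1) that by blast
  have "gamma x I < 1 \<and> (w_of x I, t_of x I) \<in> {(w, t), (- w, - t)}"
  proof (cases "t > 0")
    case True
    then show ?thesis
      using unit_vector_of_equidistant[OF finI indep c w(1) True inI] by simp
  next
    case False
    \<comment> \<open>As \<open>s\<close> in \<open>unit_vector_of_equidistant\<close> is positive,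
      a negative height is reached through the reflected pair \<open>(- w, - t)\<close>.\<close>
    have c': "- w = (\<Sum>i\<in>I. (- c i) *\<^sub>R x i)" using c by (simp add: sum_negf)
    have t': "- t > 0" using False t by simp
    have w': "norm (- w) = 1" "\<And>i. i \<in> I \<Longrightarrow> - w \<bullet> x i = - t" using w(1) inI by simp_all
    show ?thesis
      using unit_vector_of_equidistant[OF finI indep c' w'(1) t' w'(2)] by simp
  qed
  moreover have "I \<in> Phi1 N x" if "gamma x I < 1"
  proof -
    have rk: "rank_on I (lifted x) = card I" by (rule rank_on_independent[OF indep])
    have "I \<noteq> {}" using c w(1) by auto
    then have "1 \<le> card I" using finI by (simp add: Suc_le_eq card_gt_0_iff)
    moreover have "card I \<le> CARD('n)"
      using I(5) dim_subset_UNIV[of "x ` ?A"] by simp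
    moreover have "I \<subseteq> {1..N}" using I(1) J by auto
    moreover from this have "card I \<le> rank_on {1..N} (lifted x)"
      unfolding rk[symmetric] rank_on_def by (intro dim_subset image_mono)
    ultimately show ?thesis using rk that by (simp add: Phi1_def)
  qed
  ultimately show ?thesis using that by blast
qed

text \<open>
  Among the half-spaces through the origin containing \<open>J\<close>, one with the most points on its boundary
  hyperplane cannot be tilted about these points without first hitting a new one. Hence either the
  boundary points determine the hyperplane, or they are all of the points.
\<close>

lemma max_boundary_halfspace:
  fixes x :: "nat \<Rightarrow> real^'n"
  assumes w0: "norm w0 = 1" "\<And>i. i \<in> J \<Longrightarrow> 0 \<le> w0 \<bullet> x i" and J: "J \<subseteq> {1..N}"
  obtains w where "norm w = 1" "\<And>i. i \<in> J \<Longrightarrow> 0 \<le> w \<bullet> x i"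
    "{i \<in> {1..N}. w \<bullet> x i = 0} = {1..N} \<or>
      (\<forall>u. (\<forall>i \<in> {1..N}. w \<bullet> x i = 0 \<longrightarrow> u \<bullet> x i = 0) \<longrightarrow> u \<in> span {w})"
proof -
  define B where "B w = {i \<in> {1..N}. w \<bullet> x i = 0}" for w
  define P where "P w \<longleftrightarrow> norm w = 1 \<and> (\<forall>i\<in>J. 0 \<le> w \<bullet> x i)" for w
  have finB: "finite (B w)" for w by (simp add: B_def)
  have "card (B w) \<le> card {1..N}" for w
    by (rule card_mono) (auto simp: B_def)
  then have "\<exists>w. P w \<and> (\<forall>y. P y \<longrightarrow> card (B y) \<le> card (B w))"
    using w0 by (intro ex_has_greatest_nat[of P w0 _ "Suc N"]) (auto simp: P_def less_Suc_eq_le)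
  then obtain w where Pw: "P w" and max: "\<And>y. P y \<Longrightarrow> card (B y) \<le> card (B w)" by blast
  have key: "u \<in> span {w}" if u: "\<And>i. i \<in> B w \<Longrightarrow> u \<bullet> x i = 0" and k: "k \<in> {1..N}" "k \<notin> B w" for u k
  proof (rule ccontr)
    assume notin: "u \<notin> span {w}"
    \<comment> \<open>Adding \<open>w\<close> if necessary makes the tilting direction nonzero at
      \<open>x k\<close>, while it still vanishes on the boundary points and stays outside the line
      of \<open>w\<close>.\<close>
    define u' where "u' = (if u \<bullet> x k = 0 then u + w else u)"
    have wk: "w \<bullet> x k \<noteq> 0" using k by (auto simp: B_def)
    have u'k: "u' \<bullet> x k \<noteq> 0" using wk by (simp add: u'_def inner_left_distrib)
    have u'B: "u' \<bullet> x i = 0" if "i \<in> B w" for i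
      using u[OF that] that by (simp add: u'_def inner_left_distrib B_def)
    have notin': "u' \<notin> span {w}"
      using notin span_diff[of "u + w" "{w}" w] by (auto simp: u'_def span_base)
    define C where "C = {i \<in> {1..N}. u' \<bullet> x i \<noteq> 0}"
    \<comment> \<open>The vector \<open>w - r i *\<^sub>R u'\<close> is orthogonal to
      \<open>x i\<close>. The smallest \<open>\<bar>r i\<bar>\<close> marks the first new point hit
      when tilting in either direction; until then no point of \<open>J\<close> changes
      side.\<close>
    define r where "r i = w \<bullet> x i / (u' \<bullet> x i)" for i
    have "finite C" "C \<noteq> {}" using u'k k by (auto simp: C_def)
    then have "Min ((\<lambda>i. \<bar>r i\<bar>) ` C) \<in> (\<lambda>i. \<bar>r i\<bar>) ` C" by (intro Min_in) auto
    then obtain m where m: "m \<in> C" "\<bar>r m\<bar> = Min ((\<lambda>i. \<bar>r i\<bar>) ` C)" by auto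
    have min: "\<bar>r m\<bar> \<le> \<bar>r i\<bar>" if "i \<in> C" for i
      unfolding m(2) using \<open>finite C\<close> that by (intro Min_le) auto
    define y where "y = w - r m *\<^sub>R u'"
    have mB: "m \<in> {1..N}" "m \<notin> B w" using m(1) u'B by (auto simp: C_def)
    have rm: "r m \<noteq> 0" using mB m(1) by (auto simp: r_def B_def C_def)
    have y0: "y \<noteq> 0"
    proof
      assume "y = 0"
      then have "u' = (1 / r m) *\<^sub>R w" using rm by (simp add: y_def)
      then show False using notin' by (simp add: span_scale span_base)
    qed
    have yx: "y \<bullet> x i = w \<bullet> x i - r m * (u' \<bullet> x i)" for i
      by (simp add: y_def inner_diff_left)
    have "0 \<le> y \<bullet> x i" if i: "i \<in> J" for i
    proof (cases "u' \<bullet> x i = 0")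
      case True
      then show ?thesis using i Pw by (simp add: yx P_def)
    next
      case False
      then have "\<bar>r m\<bar> * \<bar>u' \<bullet> x i\<bar> \<le> \<bar>r i\<bar> * \<bar>u' \<bullet> x i\<bar>"
        using i J by (intro mult_right_mono min) (auto simp: C_def)
      also have "\<dots> = \<bar>w \<bullet> x i\<bar>" using False by (simp add: r_def)
      also have "\<dots> = w \<bullet> x i" using i Pw by (simp add: P_def)
      finally have "\<bar>r m * (u' \<bullet> x i)\<bar> \<le> w \<bullet> x i" by (simp add: abs_mult)
      then show ?thesis by (simp add: yx)
    qed
    then have "P ((1 / norm y) *\<^sub>R y)" using y0 by (simp add: P_def)
    then have "card (B ((1 / norm y) *\<^sub>R y)) \<le> card (B w)" by (rule max)
    moreover have "insert m (B w) \<subseteq> B ((1 / norm y) *\<^sub>R y)"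
    proof -
      have "y \<bullet> x m = 0" using m(1) by (simp add: yx r_def C_def)
      moreover have "y \<bullet> x i = 0" if "i \<in> B w" for i
        using that u'B[OF that] by (simp add: yx B_def)
      ultimately show ?thesis using mB(1) by (auto simp: B_def)
    qed
    then have "card (insert m (B w)) \<le> card (B ((1 / norm y) *\<^sub>R y))"
      by (intro card_mono finB)
    ultimately show False using mB(2) finB by simp
  qed
  have "B w = {1..N} \<or> (\<forall>u. (\<forall>i \<in> B w. u \<bullet> x i = 0) \<longrightarrow> u \<in> span {w})"
  proof (cases "{1..N} \<subseteq> B w")
    case True
    then show ?thesis by (auto simp: B_def)
  next
    case False
    then obtain k where "k \<in> {1..N}" "k \<notin> B w" by blast
    then show ?thesis using key by blast
  qed
  then show ?thesis
    using Pw by (intro that[of w]) (auto simp: P_def B_def)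
qed

text \<open>Otherwise the component \<open>(u, r)\<close> of the last unit vector orthogonal to the
  span has \<open>r > 0\<close>, and orthogonality to the lifts gives
  \<open>u \<bullet> x i = r\<close> on the boundary points in \<open>J\<close>. A small move of
  \<open>w\<close> along \<open>u\<close> then makes all products on \<open>J\<close> positive,
  contradicting optimality.\<close>

lemma last_axis_in_span_boundary:
  fixes x :: "nat \<Rightarrow> real^'n"
  assumes w: "norm w = 1" "\<And>i. i \<in> J \<Longrightarrow> 0 \<le> w \<bullet> x i" and J: "J \<subseteq> {1..N}"
    and opt: "\<And>y. \<exists>i\<in>J. y \<bullet> x i \<le> 0"
  shows "lift_vec 0 1 \<in> span (lifted x ` {i \<in> {1..N}. w \<bullet> x i = 0})"
proof (rule ccontr)
  let ?S = "lifted x ` {i \<in> {1..N}. w \<bullet> x i = 0}" and ?e = "lift_vec 0 1 :: real^('n option)"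
  assume notin: "?e \<notin> span ?S"
  obtain a z where az: "a \<in> span ?S" "\<And>v. v \<in> span ?S \<Longrightarrow> orthogonal z v" "?e = a + z"
    by (rule orthogonal_subspace_decomp_exists[of ?S ?e]) (rule that)
  obtain u r where z: "z = lift_vec u r" by (rule lift_vec_cases)
  have "z \<noteq> 0" using notin az(1,3) by auto
  then have "0 < z \<bullet> z" by simp
  also have "z \<bullet> z = z \<bullet> ?e"
    using az(2)[OF az(1)] unfolding az(3) by (simp add: inner_right_distrib orthogonal_def)
  also have "\<dots> = r" by (simp add: z inner_lift_vec)
  finally have r: "0 < r" .
  have uB: "u \<bullet> x i = r" if "i \<in> J" "w \<bullet> x i = 0" for i
  proof -
    have "orthogonal z (lifted x i)" using that J by (intro az(2) span_base) auto
    then show ?thesis by (simp add: z lifted_eq inner_lift_vec orthogonal_def)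
  qed
  have "\<forall>\<^sub>F e in at_right 0. \<forall>i\<in>{i \<in> J. 0 < w \<bullet> x i}. 0 * norm (w + e *\<^sub>R u) < (w + e *\<^sub>R u) \<bullet> x i"
    by (rule eventually_inner_gt_perturbed) (use J in \<open>auto intro: finite_subset\<close>)
  then have "\<forall>\<^sub>F e in at_right 0. \<forall>i\<in>{i \<in> J. 0 < w \<bullet> x i}. 0 < (w + e *\<^sub>R u) \<bullet> x i"
    by (simp only: mult_zero_left)
  from eventually_happens'[OF trivial_limit_at_right_real
      eventually_conj[OF this eventually_at_right_less]]
  obtain e where e: "0 < e" and K: "\<And>i. i \<in> J \<Longrightarrow> 0 < w \<bullet> x i \<Longrightarrow> 0 < (w + e *\<^sub>R u) \<bullet> x i"
    by blast
  have "0 < (w + e *\<^sub>R u) \<bullet> x i" if i: "i \<in> J" for i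
  proof (cases "w \<bullet> x i = 0")
    case True
    then show ?thesis using uB[OF i True] e r by (simp add: inner_left_distrib)
  next
    case False
    then show ?thesis using K[OF i] w(2)[OF i] by simp
  qed
  then show False using opt[of "w + e *\<^sub>R u"] by (meson not_le)
qed

text \<open>Orthogonality of \<open>(v, 0)\<close> to the lifts of \<open>I\<close> extends to their
  span. So a kernel vector for a basis annihilates all boundary points.\<close>

lemma orthogonal_span_lifted:
  assumes "\<And>i. i \<in> I \<Longrightarrow> v \<bullet> x i = 0" "span (lifted x ` I) = span (lifted x ` B)" "i \<in> B"
  shows "v \<bullet> x i = 0"
proof -
  have "lifted x i \<in> span (lifted x ` I)" using assms(2,3) by (simp add: span_base)
  then have "orthogonal (lift_vec v 0) (lifted x i)"
    by (rule orthogonal_to_span)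
      (use assms(1) in \<open>auto simp: lifted_eq inner_lift_vec orthogonal_def\<close>)
  then show ?thesis by (simp add: lifted_eq inner_lift_vec orthogonal_def)
qed

lemma optimal_in_Phi0:
  fixes x :: "nat \<Rightarrow> real^'n"
  assumes J: "J \<subseteq> {1..N}" and w0: "norm w0 = 1" "\<And>i. i \<in> J \<Longrightarrow> 0 \<le> w0 \<bullet> x i"
    and opt: "\<And>y. \<exists>i\<in>J. y \<bullet> x i \<le> 0"
  obtains I where "I \<in> Phi0 N x"
    "\<And>v. v \<in> ker_transpose x I \<inter> sphere 0 1 \<Longrightarrow>
      (\<forall>i\<in>J. 0 \<le> v \<bullet> x i) \<or> (\<forall>i\<in>J. 0 \<le> - v \<bullet> x i)"
proof -
  obtain w where w: "norm w = 1" "\<And>i. i \<in> J \<Longrightarrow> 0 \<le> w \<bullet> x i"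
    and alt: "{i \<in> {1..N}. w \<bullet> x i = 0} = {1..N} \<or>
      (\<forall>u. (\<forall>i \<in> {1..N}. w \<bullet> x i = 0 \<longrightarrow> u \<bullet> x i = 0) \<longrightarrow> u \<in> span {w})"
    by (rule max_boundary_halfspace[where x = x and J = J, OF w0 J]) (assumption | rule that)+
  define B where "B = {i \<in> {1..N}. w \<bullet> x i = 0}"
  let ?e = "lift_vec 0 1 :: real^('n option)"
  have e: "?e \<in> span (lifted x ` B)"
    unfolding B_def by (rule last_axis_in_span_boundary[OF w J opt])
  have alt: "B = {1..N} \<or> (\<forall>u. (\<forall>i\<in>B. u \<bullet> x i = 0) \<longrightarrow> u \<in> span {w})"
    using alt by (auto simp: B_def)
  have le: "dim (lifted x ` B) \<le> CARD('n)"
  proof -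
    have "w \<noteq> 0" using w(1) by auto
    then have "dim {y. lift_vec w 0 \<bullet> y = 0} = CARD('n)"
      by (subst dim_hyperplane) (simp_all add: lift_eq_0)
    moreover have "lifted x ` B \<subseteq> {y. lift_vec w 0 \<bullet> y = 0}"
      by (auto simp: B_def lifted_eq inner_lift_vec)
    ultimately show ?thesis using dim_subset by metis
  qed
  have le': "dim (lifted x ` B) \<le> dim (lifted x ` {1..N})"
    by (rule dim_subset) (auto simp: B_def)
  have rank: "dim (lifted x ` B) = min CARD('n) (dim (lifted x ` {1..N}))"
    using alt
  proof
    assume "B = {1..N}"
    then show ?thesis using le by simp
  next
    assume ker: "\<forall>u. (\<forall>i\<in>B. u \<bullet> x i = 0) \<longrightarrow> u \<in> span {w}"
    let ?S = "span (lifted x ` B)"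
    let ?T = "{y \<in> UNIV. \<forall>z\<in>?S. orthogonal z y}"
    \<comment> \<open>The orthogonal complement of the lifted boundary points is at most a line: the
      last unit vector lies in their span, so \<open>y\<close> has last entry 0, and its remaining
      part is a multiple of \<open>w\<close> by \<open>ker\<close>. Counting dimensions then shows
      that their rank is at least \<open>n\<close>.\<close>
    have "y \<in> span {lift_vec w 0}" if y: "y \<in> ?T" for y
    proof -
      obtain u r where ur: "y = lift_vec u r" by (rule lift_vec_cases)
      have r: "r = 0" using y e by (auto simp: ur orthogonal_def inner_lift_vec)
      have "u \<bullet> x i = 0" if "i \<in> B" for i
      proof -
        have "orthogonal (lifted x i) y" using y that by (auto intro: span_base)
        then show ?thesis by (simp add: ur r orthogonal_def inner_lift_vec lifted_eq inner_commute)
      qed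
      then have "u \<in> span {w}" using ker by blast
      then obtain k where "u = k *\<^sub>R w" by (auto simp: span_singleton)
      then have "y = k *\<^sub>R lift_vec w 0"
        by (auto simp: ur r lift_vec_def vec_eq_iff split: option.split)
      then show ?thesis by (simp add: span_scale span_base)
    qed
    then have "dim ?T \<le> dim (span {lift_vec w 0})" by (intro dim_subset) blast
    also have "\<dots> \<le> 1" using dim_le_card'[of "{lift_vec w 0}"] by simp
    finally have "dim ?T \<le> 1" .
    moreover have "dim ?T + dim ?S = CARD('n) + 1"
      by (subst dim_subspace_orthogonal_to_vectors) simp_all
    ultimately show ?thesis using le le' by simp
  qed
  \<comment> \<open>Here the basis is taken among the lifts, because \<open>Phi0\<close> prescribes
    the lifted rank, which exceeds that of the points by one when the span contains
    \<open>?e\<close>.\<close>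
  obtain I where I: "I \<subseteq> B" "independent (lifted x ` I)" "inj_on (lifted x) I"
    "span (lifted x ` I) = span (lifted x ` B)" "card I = dim (lifted x ` B)"
    by (rule family_basis)
  have finI: "finite I" using I(1) by (auto simp: B_def intro: finite_subset)
  have "I \<noteq> {}" using e unfolding I(4)[symmetric] by (auto simp: lift_eq_0)
  then have "1 \<le> card I" using finI by (simp add: Suc_le_eq card_gt_0_iff)
  moreover have "rank_on I (lifted x) = card I" by (rule rank_on_independent[OF I(2,3)])
  moreover have "gamma x I = 1" by (rule gamma_eq_1[OF finI I(2,3)]) (simp add: I(4) e)
  ultimately have Phi0: "I \<in> Phi0 N x"
    using I(1,5) rank by (auto simp: Phi0_def B_def rank_on_def)
  show ?thesis
  proof (rule that[OF Phi0])
    fix v assume v: "v \<in> ker_transpose x I \<inter> sphere 0 1"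
    have vB: "v \<bullet> x i = 0" if "i \<in> B" for i
      by (rule orthogonal_span_lifted[OF _ I(4) that]) (use v in \<open>auto simp: ker_transpose_def\<close>)
    from alt show "(\<forall>i\<in>J. 0 \<le> v \<bullet> x i) \<or> (\<forall>i\<in>J. 0 \<le> - v \<bullet> x i)"
    proof
      assume "B = {1..N}"
      then have "v \<bullet> x i = 0" if "i \<in> J" for i using vB J that by blast
      then show ?thesis by simp
    next
      assume "\<forall>u. (\<forall>i\<in>B. u \<bullet> x i = 0) \<longrightarrow> u \<in> span {w}"
      then have "v \<in> span {w}" using vB by blast
      then obtain k where k: "v = k *\<^sub>R w" by (auto simp: span_singleton)
      then show ?thesis using w(2) by (cases "0 \<le> k") (auto simp: mult_nonpos_nonneg)
    qed
  qed
qed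

section \<open>Comparison of excesses with the finite maxima\<close>

lemma excess_le_disc_at:
  fixes x :: "nat \<Rightarrow> real^'n" and w w' :: "real^'n"
  assumes "norm w = 1" "norm w' = 1" "s \<le> t" "J \<subseteq> {1..N}" "\<And>i. i \<in> J \<Longrightarrow> t \<le> w' \<bullet> x i"
  shows "card J / N - mu_cap w s \<le> disc_at N x w' t"
proof -
  have "card J \<le> card {i \<in> {1..N}. x i \<in> halfspace w' t}"
    by (rule card_mono) (use assms(4,5) in \<open>auto simp: halfspace_def\<close>)
  then have "card J / N \<le> mu_emp N x w' t"
    by (simp add: mu_emp_def divide_right_mono)
  \<comment> \<open>Raising the height at any centre does not increase the measure, so the optimal
    cap, still containing \<open>J\<close>, has at least the original excess.\<close>
  moreover have "mu_cap w' t \<le> mu_cap w s"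
    using mu_cap_antimono[OF assms(3)] mu_cap_rotate[OF assms(1,2)] by metis
  ultimately show ?thesis by (simp add: disc_at_def)
qed

lemma disc_at_le_Delta1:
  assumes "I \<in> Phi1 N x"
  shows "disc_at N x (w_of x I) (t_of x I) \<le> Delta1 N x"
    "disc_at N x (- w_of x I) (- t_of x I) \<le> Delta1 N x"
proof -
  have "finite (Phi1 N x)" by (rule finite_subset[of _ "Pow {1..N}"]) (auto simp: Phi1_def)
  then have "max (disc_at N x (w_of x I) (t_of x I)) (disc_at N x (- w_of x I) (- t_of x I)) \<le> Delta1 N x"
    unfolding Delta1_def using assms by (subst if_P) (blast, intro Max_ge finite_imageI imageI)
  then show "disc_at N x (w_of x I) (t_of x I) \<le> Delta1 N x"
    "disc_at N x (- w_of x I) (- t_of x I) \<le> Delta1 N x" by simp_all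
qed

lemma disc_at_le_Delta0:
  assumes "I \<in> Phi0 N x"
  shows "disc_at N x (v I) 0 \<le> Delta0 N x v" "disc_at N x (- v I) 0 \<le> Delta0 N x v"
proof -
  have "finite (Phi0 N x)" by (rule finite_subset[of _ "Pow {1..N}"]) (auto simp: Phi0_def)
  then have "max (disc_at N x (v I) 0) (disc_at N x (- v I) 0) \<le> Delta0 N x v"
    unfolding Delta0_def using assms by (subst if_P) (blast, intro Max_ge finite_imageI imageI)
  then show "disc_at N x (v I) 0 \<le> Delta0 N x v" "disc_at N x (- v I) 0 \<le> Delta0 N x v"
    by simp_all
qed

text \<open>The hypothesis \<open>0 \<le> d\<close> covers the default value for an empty
  family.\<close>

lemma Delta1_least:
  assumes "0 \<le> d" "\<And>I. I \<in> Phi1 N x \<Longrightarrow> disc_at N x (w_of x I) (t_of x I) \<le> d"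
    "\<And>I. I \<in> Phi1 N x \<Longrightarrow> disc_at N x (- w_of x I) (- t_of x I) \<le> d"
  shows "Delta1 N x \<le> d"
proof -
  have "finite (Phi1 N x)" by (rule finite_subset[of _ "Pow {1..N}"]) (auto simp: Phi1_def)
  then show ?thesis using assms by (simp add: Delta1_def)
qed

lemma Delta0_least:
  assumes "0 \<le> d" "\<And>I. I \<in> Phi0 N x \<Longrightarrow> disc_at N x (v I) 0 \<le> d"
    "\<And>I. I \<in> Phi0 N x \<Longrightarrow> disc_at N x (- v I) 0 \<le> d"
  shows "Delta0 N x v \<le> d"
proof -
  have "finite (Phi0 N x)" by (rule finite_subset[of _ "Pow {1..N}"]) (auto simp: Phi0_def)
  then show ?thesis using assms by (simp add: Delta0_def)
qed

lemma Delta1_nonneg: "0 \<le> Delta1 N x"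
proof (cases "Phi1 N x = {}")
  case False
  then obtain I where "I \<in> Phi1 N x" by blast
  then show ?thesis
    using disc_at_le_Delta1(1)[of I N x] by (simp add: disc_at_def)
qed (simp add: Delta1_def)

lemma disc_at_le_cap_discrepancy:
  assumes "w \<in> sphere 0 1" "t \<in> {-1..1}"
  shows "disc_at N x w t \<le> cap_discrepancy N x"
proof -
  have bdd: "bdd_above ((\<lambda>(w, t). disc_at N x w t) ` (sphere 0 1 \<times> {-1..1}))"
    by (rule bdd_aboveI[of _ 1]) (auto simp: disc_at_le_1)
  then show ?thesis
    unfolding cap_discrepancy_def using cSUP_upper[OF _ bdd, of "(w, t)"] assms by simp
qed

lemma excess_le_Delta:
  fixes x :: "nat \<Rightarrow> real^'n"
  assumes x: "\<And>i. i \<in> {1..N} \<Longrightarrow> x i \<in> sphere 0 1"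
    and v: "\<And>I. I \<in> Phi0 N x \<Longrightarrow> v I \<in> ker_transpose x I \<inter> sphere 0 1"
    and J: "J \<subseteq> {1..N}" "J \<noteq> {}"
    and w: "norm w = 1" "s \<in> {-1..1}" "\<And>i. i \<in> J \<Longrightarrow> s \<le> w \<bullet> x i"
  shows "card J / N - mu_cap w s \<le> max (Delta1 N x) (Delta0 N x v)"
proof -
  have nx: "norm (x i) = 1" if "i \<in> J" for i using x J(1) that by auto
  have "finite J" using J(1) by (rule finite_subset) simp
  then obtain w' t where w': "norm w' = 1" "s \<le> t" "t \<in> {-1..1}" "\<And>i. i \<in> J \<Longrightarrow> t \<le> w' \<bullet> x i"
    and opt: "\<And>y. \<exists>i\<in>J. y \<bullet> x i \<le> t * norm y"
    by (rule optimal_halfspace_exists[where x = x, OF _ J(2) nx w]) (assumption | rule that)+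
  note le = excess_le_disc_at[where x = x, OF w(1) _ w'(2) J(1)]
  show ?thesis
  proof (cases "t = 0")
    case False
    obtain I where I: "I \<in> Phi1 N x"
      "(w_of x I, t_of x I) = (w', t) \<or> (w_of x I, t_of x I) = (- w', - t)"
      by (rule optimal_in_Phi1[OF J(1) w'(1,4) opt False])
    have "disc_at N x w' t \<le> Delta1 N x"
      using I(2) disc_at_le_Delta1[OF I(1)] by auto
    then show ?thesis using le[OF w'(1,4)] by linarith
  next
    case True
    have w'0: "0 \<le> w' \<bullet> x i" if "i \<in> J" for i using w'(4)[OF that] by (simp add: True)
    have opt0: "\<exists>i\<in>J. y \<bullet> x i \<le> 0" for y using opt[of y] by (simp add: True)
    obtain I where I: "I \<in> Phi0 N x"
      and *: "\<And>v. v \<in> ker_transpose x I \<inter> sphere 0 1 \<Longrightarrow>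
        (\<forall>i\<in>J. 0 \<le> v \<bullet> x i) \<or> (\<forall>i\<in>J. 0 \<le> - v \<bullet> x i)"
      by (rule optimal_in_Phi0[where x = x, OF J(1) w'(1) w'0 opt0]) (assumption | rule that)+
    have nv: "norm (v I) = 1" "norm (- v I) = 1" using v[OF I] by auto
    \<comment> \<open>Only the line of the kernel vector is determined, not its sign; the maximum in
      \<open>Delta0\<close> over both signs accounts for this.\<close>
    have "card J / N - mu_cap w s \<le> disc_at N x (v I) 0 \<or>
      card J / N - mu_cap w s \<le> disc_at N x (- v I) 0"
      using *[OF v[OF I]] le[OF nv(1)] le[OF nv(2)] by (auto simp: True)
    then show ?thesis using disc_at_le_Delta0[OF I, of v] by auto
  qed
qed

theorem theorem1:
  fixes N :: nat
    and x :: "nat \<Rightarrow> real^'n"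
    and v :: "nat set \<Rightarrow> real^'n"
  assumes "N \<ge> 1"
    and "\<And>i. i \<in> {1..N} \<Longrightarrow> x i \<in> sphere 0 1"
    and "\<And>I. I \<in> Phi0 N x \<Longrightarrow> v I \<in> ker_transpose x I \<inter> sphere 0 1"
  shows "cap_discrepancy N x = max (Delta1 N x) (Delta0 N x v)"
proof (rule antisym)
  have ne: "axis undefined 1 \<in> (sphere 0 1 :: (real^'n) set)" by (simp add: norm_axis_1)
  have "disc_at N x w t \<le> max (Delta1 N x) (Delta0 N x v)"
    if w: "norm w = 1" and t: "t \<in> {-1..1}" for w t
  \<comment> \<open>Positivity guarantees a nonempty \<open>J\<close> for the excess bound; a
    vanishing discrepancy is covered by \<open>Delta1_nonneg\<close>.\<close>
  proof (cases "disc_at N x w t > 0")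
    case True
    have nx: "norm (x i) = 1" if "i \<in> {1..N}" for i using assms(2)[OF that] by simp
    obtain w' s J where "norm w' = 1" "s \<in> {-1..1}" "J \<subseteq> {1..N}" "J \<noteq> {}"
      "\<And>i. i \<in> J \<Longrightarrow> s \<le> w' \<bullet> x i" and le: "disc_at N x w t \<le> card J / N - mu_cap w' s"
      by (rule disc_at_le_excess[where x = x, OF assms(1) nx w t True]) (assumption | rule that)+
    then have "card J / N - mu_cap w' s \<le> max (Delta1 N x) (Delta0 N x v)"
      by (intro excess_le_Delta assms(2,3))
    with le show ?thesis by linarith
  next
    case False
    then show ?thesis using Delta1_nonneg[of N x] by linarith
  qed
  then show "cap_discrepancy N x \<le> max (Delta1 N x) (Delta0 N x v)"
    unfolding cap_discrepancy_def using ne by (intro cSUP_least) auto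
  have nonneg: "0 \<le> cap_discrepancy N x"
    using disc_at_le_cap_discrepancy[OF ne, of 0 N x] by (simp add: disc_at_def)
  have "Delta1 N x \<le> cap_discrepancy N x"
  proof (rule Delta1_least[OF nonneg])
    fix I assume "I \<in> Phi1 N x"
    note * = unit_vector_of_Phi1[OF this assms(2)]
    show "disc_at N x (w_of x I) (t_of x I) \<le> cap_discrepancy N x"
      "disc_at N x (- w_of x I) (- t_of x I) \<le> cap_discrepancy N x"
      using * by (auto intro!: disc_at_le_cap_discrepancy)
  qed
  moreover have "Delta0 N x v \<le> cap_discrepancy N x"
    using assms(3) by (intro Delta0_least[OF nonneg] disc_at_le_cap_discrepancy) auto
  ultimately show "max (Delta1 N x) (Delta0 N x v) \<le> cap_discrepancy N x" by simp
qed

end
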